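(* Let $\mathcal A$ be a gargantuan labeled combinatorial class whose counting sequence $(\mathfrak a_n)_{n\ge 0}$ is positive ($\mathfrak a_n>0$ for all $n$), and suppose $\mathcal A=\mathrm{SET}(\mathcal C)=\mathrm{SEQ}(\mathcal D)$ for some labeled combinatorial classes $\mathcal C$ and $\mathcal D$ with counting sequences $(\mathfrak c_n)$ and $(\mathfrak d_n)$. Let $a$ be an object of $\mathcal A$ of size $n$ chosen uniformly at random. Then $$\mathbb P(a \text{ is SET-irreducible})=\frac{\mathfrak c_n}{\mathfrak a_n}\approx 1-\sum_{k\ge 1}\mathfrak d_k\binom{n}{k}\frac{\mathfrak a_{n-k}}{\mathfrak a_n}.$$
   Context: A labeled combinatorial class $\mathcal A$ is a collection of objects, each with a size $n\ge 0$, the objects of size $n$ being built on the label set $[n]=\{1,\dots,n\}$, with finitely many ($\mathfrak a_n$) objects of each size; its exponential generating function is $A(z)=\sum_{n\ge0}\mathfrak a_n z^n/n!$. Classes are identified when they have the same counting sequence. For a class $\mathcal C$ with $\mathfrak c_0=0$, $\mathcal A=\mathrm{SET}(\mathcal C)$ means $A(z)=\exp(C(z))$ (objects of $\mathcal A$ are sets of components from $\mathcal C$; an object is SET-irreducible if it belongs to $\mathcal C$, so the uniform probability of being SET-irreducible at size $n$ is $\mathfrak c_n/\mathfrak a_n$). For a class $\mathcal D$ with $\mathfrak d_0=0$, $\mathcal A=\mathrm{SEQ}(\mathcal D)$ means $A(z)=1/(1-D(z))$. A sequence $(a_n)$ is gargantuan if for every fixed integer $r$, as $n\to\infty$: (i)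 $a_{n-1}/a_n\to 0$, and (ii) $\sum_{k=r}^{n-r}|a_ka_{n-k}|=O(a_{n-r})$. A labeled class is gargantuan if $(\mathfrak a_n/n!)$ is gargantuan. Notation: $a_n\approx\sum_{k\ge m}f_k(n)$ means that for every $r\ge m$, $a_n=\sum_{k=m}^r f_k(n)+O(f_{r+1}(n))$ as $n\to\infty$, and $f_{k+1}(n)=o(f_k(n))$ for every $k\ge m$. In the claim the $k=0$ term is the constant $1$.
   Formalization: The literal ≈ fails if some d_k=0, k≥1 (e.g. graphs: d_2=0, d_3=2), so it is stated only when all d_k≠0 for k≥1; in general the error after the term k=r is O(binom(n,r+1)a_{n-r-1}/a_n), and each of these scale functions is o of the previous one. *)

theory Defs
  imports
    "HOL-Computational_Algebra.Formal_Power_Series"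
    "HOL-Library.Landau_Symbols"
    "HOL-Probability.Probability_Mass_Function"
begin

(* The label set of an object of size n is {1..n}, hence is determined by the size and is
   not recorded separately. *)
record 'a lclass =
  objects :: "'a set"
  osize :: "'a \<Rightarrow> nat"

definition objects_of_size :: "'a lclass \<Rightarrow> nat \<Rightarrow> 'a set" where
  "objects_of_size A n = {x \<in> objects A. osize A x = n}"

definition labeled_class :: "'a lclass \<Rightarrow> bool" where
  "labeled_class A \<longleftrightarrow> (\<forall>n. finite (objects_of_size A n))"

definition counting :: "'a lclass \<Rightarrow> nat \<Rightarrow> nat" where
  "counting A n = card (objects_of_size A n)"

definition egf :: "'a lclass \<Rightarrow> real fps" where
  "egf A = Abs_fps (\<lambda>n. real (counting A n) / fact n)"

(* Classes are identified when their counting sequences agree, so A = SET(C) and A = SEQ(D)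
   are identities between exponential generating functions. *)
definition is_SET :: "'a lclass \<Rightarrow> 'c lclass \<Rightarrow> bool" where
  "is_SET A C \<longleftrightarrow> counting C 0 = 0 \<and> egf A = fps_compose (fps_exp 1) (egf C)"

definition is_SEQ :: "'a lclass \<Rightarrow> 'd lclass \<Rightarrow> bool" where
  "is_SEQ A D \<longleftrightarrow> counting D 0 = 0 \<and> egf A = 1 / (1 - egf D)"

(* A way of viewing the components (objects of C) as objects of A. Since classes are only
   determined up to their counting sequences, any size-preserving injection may serve. *)
definition component_embedding :: "('c \<Rightarrow> 'a) \<Rightarrow> 'c lclass \<Rightarrow> 'a lclass \<Rightarrow> bool" where
  "component_embedding \<iota> C A \<longleftrightarrow> inj_on \<iota> (objects C) \<and>
     (\<forall>x \<in> objects C. \<iota> x \<in> objects A \<and> osize A (\<iota> x) = osize C x)"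

definition SET_irreducible :: "('c \<Rightarrow> 'a) \<Rightarrow> 'c lclass \<Rightarrow> 'a \<Rightarrow> bool" where
  "SET_irreducible \<iota> C x \<longleftrightarrow> x \<in> \<iota> ` objects C"

(* The truncated subtractions only affect finitely many n for each r. *)
definition gargantuan :: "(nat \<Rightarrow> real) \<Rightarrow> bool" where
  "gargantuan a \<longleftrightarrow>
     ((\<lambda>n. a (n - 1) / a n) \<longlonglongrightarrow> 0) \<and>
     (\<forall>r::nat. (\<lambda>n. \<Sum>k=r..n-r. \<bar>a k * a (n - k)\<bar>) \<in> O(\<lambda>n. a (n - r)))"

definition gargantuan_class :: "'a lclass \<Rightarrow> bool" where
  "gargantuan_class A \<longleftrightarrow> gargantuan (\<lambda>n. real (counting A n) / fact n)"

(* Expansion of a into the terms f k (k \<ge> m), with errors measured on the asymptotic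
   scale \<phi>. *)
definition expansion_on_scale ::
  "nat \<Rightarrow> (nat \<Rightarrow> nat \<Rightarrow> real) \<Rightarrow> (nat \<Rightarrow> real) \<Rightarrow> (nat \<Rightarrow> nat \<Rightarrow> real) \<Rightarrow> bool" where
  "expansion_on_scale m \<phi> a f \<longleftrightarrow>
     (\<forall>r\<ge>m. (\<lambda>n. a n - (\<Sum>k=m..r. f k n)) \<in> O(\<phi> (r + 1))) \<and>
     (\<forall>k\<ge>m. \<phi> (k + 1) \<in> o(\<phi> k))"

(* a n \<approx> (\<Sum>k\<ge>m. f k n): the terms are their own scale. This fails for most series
   having a vanishing term f k, because O(0) and o(0) contain only the functions that
   are eventually 0. *)
definition asymp_series :: "nat \<Rightarrow> (nat \<Rightarrow> real) \<Rightarrow> (nat \<Rightarrow> nat \<Rightarrow> real) \<Rightarrow> bool" where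
  "asymp_series m a f \<longleftrightarrow> expansion_on_scale m f a f"

definition SET_scale :: "'a lclass \<Rightarrow> nat \<Rightarrow> nat \<Rightarrow> real" where
  "SET_scale A k n =
     real (n choose k) * real (counting A (n - k)) / real (counting A n)"

definition SET_term :: "'a lclass \<Rightarrow> 'd lclass \<Rightarrow> nat \<Rightarrow> nat \<Rightarrow> real" where
  "SET_term A D k n =
     (if k = 0 then 1
      else - (real (counting D k) * real (n choose k) *
                real (counting A (n - k)) / real (counting A n)))"

end

(* Write A, C, D for the exponential generating functions, a_n for the coefficients of A, and
   put E = 1/A = 1 - D, so that |e_k| <= a_k. Differentiating A = exp(C) gives C' = A' E, i.e.
     n c_n = sum_k e_k (n-k) a_{n-k}.
   By the gargantuan property the terms with m <= k <= n-m contribute n O(a_{n-m}). The terms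
   with k < m give n times the desired expansion minus sum_{k<m} k e_k a_{n-k}, and this defect
   is cancelled, up to O(a_{n-m}), by the terms j a_j e_{n-j} with j = n-k < m. Indeed A E = 1
   yields, again dropping the middle terms,
     sum_{k<m} a_k e_{n-k} + sum_{k<m} e_k a_{n-k} = O(a_{n-m})   for every m,
   and convolving this relation with the coefficients of z A' E turns the two coefficient series
   into z A' E A = z A' and z A' E^2 = -z E'. *)
theory Submission imports Defs begin

unbundle no vec_syntax
unbundle fps_syntax

section \<open>Finite sums and truncated convolutions of asymptotic relations\<close>

lemma sum_split_ends:
  fixes h :: "nat \<Rightarrow> 'a :: comm_monoid_add"
  assumes "2 * m \<le> n"
  shows "(\<Sum>k\<le>n. h k) = (\<Sum>k<m. h k) + (\<Sum>k=m..n-m. h k) + (\<Sum>j<m. h (n - j))"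
proof -
  have "(\<Sum>k\<le>n. h k) = sum h ({..<m} \<union> {m..n-m} \<union> {n-m<..n})"
    using assms by (intro sum.cong) auto
  also have "\<dots> = sum h {..<m} + sum h {m..n-m} + sum h {n-m<..n}"
    using assms by (subst sum.union_disjoint; (subst sum.union_disjoint)?; auto)
  also have "sum h {n-m<..n} = (\<Sum>j<m. h (n - j))"
    using assms by (intro sum.reindex_bij_witness[of _ "\<lambda>j. n - j" "\<lambda>k. n - k"]) auto
  finally show ?thesis .
qed

text \<open>Both sides sum over the triangle \<open>l + k < m\<close>, grouped by \<open>l\<close>
  on the left and by \<open>i = l + k\<close> on the right. The inner bound \<open>m - l\<close> is
  what makes the truncated sums compatible with the product.\<close>

lemma truncated_convolution:
  fixes u v :: "'a :: comm_semiring_1 fps"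
  shows "(\<Sum>l<m. u $ l * (\<Sum>k<m-l. v $ k * s (n - l - k))) = (\<Sum>i<m. (u * v) $ i * s (n - i))"
proof -
  have "(\<Sum>i<m. (u * v) $ i * s (n - i)) = (\<Sum>i<m. \<Sum>l\<le>i. u $ l * v $ (i - l) * s (n - i))"
    by (simp add: fps_mult_nth sum_distrib_right atLeast0AtMost)
  also have "\<dots> = (\<Sum>(i, l)\<in>(SIGMA i:{..<m}. {..i}). u $ l * v $ (i - l) * s (n - i))"
    by (simp add: sum.Sigma)
  also have "\<dots> = (\<Sum>(l, k)\<in>(SIGMA l:{..<m}. {..<m-l}). u $ l * (v $ k * s (n - l - k)))"
    by (intro sum.reindex_bij_witness[of _ "\<lambda>(l, k). (l + k, l)" "\<lambda>(i, l). (l, i - l)"])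
       (auto simp: mult.assoc)
  also have "\<dots> = (\<Sum>l<m. u $ l * (\<Sum>k<m-l. v $ k * s (n - l - k)))"
    by (simp add: sum.Sigma sum_distrib_left)
  finally show ?thesis by simp
qed

lemma bigo_shift:
  fixes f g :: "nat \<Rightarrow> real"
  assumes "f \<in> O(g)"
  shows "(\<lambda>n. f (n - l)) \<in> O(\<lambda>n. g (n - l))"
  using landau_o.big.compose[OF assms filterlim_minus_const_nat_at_top[of l]] by simp

text \<open>The relation of order \<open>m - l\<close>, read at \<open>n - l\<close> and weighted by
  \<open>w $ l\<close>, has error \<open>g (n - l - (m - l)) = g (n - m)\<close>, the same for every
  \<open>l < m\<close>. Adding these finitely many relations gives the claim; this is why the
  assumption must cover all orders.\<close>

lemma truncated_relation_mult:
  fixes u v w :: "real fps" and s t g :: "nat \<Rightarrow> real"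
  assumes "\<And>m. (\<lambda>n. (\<Sum>k<m. u $ k * s (n - k)) + (\<Sum>k<m. v $ k * t (n - k))) \<in> O(\<lambda>n. g (n - m))"
  shows "(\<lambda>n. (\<Sum>k<m. (w * u) $ k * s (n - k)) + (\<Sum>k<m. (w * v) $ k * t (n - k))) \<in> O(\<lambda>n. g (n - m))"
proof -
  let ?F = "\<lambda>m n. (\<Sum>k<m. u $ k * s (n - k)) + (\<Sum>k<m. v $ k * t (n - k))"
  have "(\<lambda>n. \<Sum>l<m. w $ l * ?F (m - l) (n - l)) \<in> O(\<lambda>n. g (n - m))"
  proof (rule big_sum_in_bigo)
    fix l assume "l \<in> {..<m}"
    then show "(\<lambda>n. w $ l * ?F (m - l) (n - l)) \<in> O(\<lambda>n. g (n - m))"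
      using bigo_shift[OF assms[of "m - l"], of l]
      by (cases "w $ l = 0") simp_all
  qed
  then show ?thesis
    by (simp only: distrib_left sum.distrib truncated_convolution)
qed

section \<open>Power series with gargantuan coefficients\<close>

lemma gargantuan_middle_bigo:
  assumes "gargantuan a" and "\<And>n k. k \<le> n \<Longrightarrow> \<bar>h n k\<bar> \<le> \<bar>a k * a (n - k)\<bar>"
  shows "(\<lambda>n. \<Sum>k=m..n-m. h n k) \<in> O(\<lambda>n. a (n - m))"
proof -
  have "(\<lambda>n. \<Sum>k=m..n-m. h n k) \<in> O(\<lambda>n. \<Sum>k=m..n-m. \<bar>a k * a (n - k)\<bar>)"
  proof (rule landau_o.big_mono, rule always_eventually, rule allI)
    fix n
    have "\<bar>\<Sum>k=m..n-m. h n k\<bar> \<le> (\<Sum>k=m..n-m. \<bar>h n k\<bar>)"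
      by (rule sum_abs)
    also have "\<dots> \<le> (\<Sum>k=m..n-m. \<bar>a k * a (n - k)\<bar>)"
      by (intro sum_mono assms(2)) auto
    finally show "norm (\<Sum>k=m..n-m. h n k) \<le> norm (\<Sum>k=m..n-m. \<bar>a k * a (n - k)\<bar>)"
      by simp
  qed
  also have "\<dots> \<subseteq> O(\<lambda>n. a (n - m))"
    using assms(1) unfolding gargantuan_def by (intro landau_o.big.subsetI) blast
  finally show ?thesis .
qed

text \<open>The analytic core, free of classes: \<open>E\<close> is the inverse of \<open>A\<close>,
  and \<open>C\<close> is its logarithm up to the constant term, since only the derivative of
  \<open>C\<close> enters.\<close>

lemma gargantuan_log_bigo:
  fixes A C E :: "real fps"
  assumes garg: "gargantuan (fps_nth A)"
    and AE: "A * E = 1"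
    and E_le: "\<And>k. \<bar>E $ k\<bar> \<le> \<bar>A $ k\<bar>"
    and C: "fps_deriv C = fps_deriv A * E"
  shows "(\<lambda>n. C $ n - (\<Sum>k<m. E $ k * A $ (n - k))) \<in> O(\<lambda>n. A $ (n - m))"
proof -
  have rel: "(\<lambda>n. (\<Sum>k<m. A $ k * E $ (n - k)) + (\<Sum>k<m. E $ k * A $ (n - k))) \<in> O(\<lambda>n. A $ (n - m))"
    for m
  proof -
    have "(\<lambda>n. - (\<Sum>k=m..n-m. E $ k * A $ (n - k))) \<in> O(\<lambda>n. A $ (n - m))"
      unfolding landau_o.big.uminus_in_iff
      by (rule gargantuan_middle_bigo[OF garg]) (auto simp: abs_mult intro!: mult_right_mono E_le)
    moreover have "eventually (\<lambda>n. - (\<Sum>k=m..n-m. E $ k * A $ (n - k)) =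
      (\<Sum>k<m. A $ k * E $ (n - k)) + (\<Sum>k<m. E $ k * A $ (n - k))) sequentially"
      \<comment> \<open>This bound gives both \<open>2 * m \<le> n\<close> for the splitting and
        \<open>n > 0\<close>, where the coefficient of the series 1 vanishes.\<close>
      using eventually_ge_at_top[of "2 * m + 1"]
    proof eventually_elim
      case (elim n)
      have "0 = (E * A) $ n"
        using elim AE by (simp add: mult.commute)
      also have "\<dots> = (\<Sum>k\<le>n. E $ k * A $ (n - k))"
        by (simp add: fps_mult_nth atLeast0AtMost)
      also have "\<dots> = (\<Sum>k<m. E $ k * A $ (n - k)) + (\<Sum>k=m..n-m. E $ k * A $ (n - k))
          + (\<Sum>j<m. E $ (n - j) * A $ (n - (n - j)))"
        using elim by (intro sum_split_ends) auto
      also have "(\<Sum>j<m. E $ (n - j) * A $ (n - (n - j))) = (\<Sum>j<m. A $ j * E $ (n - j))"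
        using elim by (intro sum.cong) auto
      finally show ?case by linarith
    qed
    ultimately show ?thesis
      by (rule landau_o.big.in_cong[THEN iffD1, rotated])
  qed
  \<comment> \<open>The weight is chosen so that \<open>w A = z A'\<close> and, since \<open>A' E = - A E'\<close>, also \<open>w E = - z E'\<close>.\<close>
  define w where "w = fps_XD A * E"
  have wA: "w * A = fps_XD A"
    using AE by (simp add: w_def mult_ac)
  have "fps_deriv A * E + A * fps_deriv E = 0"
    using arg_cong[OF AE, of fps_deriv] by (simp add: add.commute)
  then have "(fps_deriv A * E + A * fps_deriv E) * E = 0" by simp
  then have "fps_deriv A * E * E + (A * E) * fps_deriv E = 0"
    by (simp add: algebra_simps)
  then have dE: "fps_deriv A * E * E = - fps_deriv E"
    using AE by (simp add: eq_neg_iff_add_eq_0)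
  have wE: "w * E = - fps_XD E"
    using dE by (simp add: w_def fps_XD_def o_def mult.assoc)
  \<comment> \<open>This is \<open>rel\<close> multiplied by \<open>w\<close>: the coefficients of
    \<open>w * A\<close> are \<open>k * A $ k\<close> and those of \<open>w * E\<close> are
    \<open>- k * E $ k\<close>.\<close>
  define R where "R n = (\<Sum>k<m. real k * A $ k * E $ (n - k)) - (\<Sum>k<m. real k * E $ k * A $ (n - k))" for n
  have R: "R \<in> O(\<lambda>n. A $ (n - m))"
    using truncated_relation_mult[OF rel, of w m]
    by (simp add: wA wE R_def[abs_def] sum_negf)
  \<comment> \<open>The summands of \<open>C $ n\<close>, with the factor \<open>1 / n\<close>
    already distributed: the quotient \<open>(n - k) / n\<close> is at most 1, so \<open>h\<close>
    stays below the gargantuan summands.\<close>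
  define h where "h n k = E $ k * (real (n - k) / real n * A $ (n - k))" for n k
  have h_le: "\<bar>h n k\<bar> \<le> \<bar>A $ k * A $ (n - k)\<bar>" if "k \<le> n" for n k
  proof -
    have "\<bar>real (n - k) / real n * A $ (n - k)\<bar> \<le> 1 * \<bar>A $ (n - k)\<bar>"
      unfolding abs_mult by (intro mult_right_mono) (auto simp: divide_le_eq_1)
    then show ?thesis
      unfolding h_def abs_mult[of "E $ k"] abs_mult[of "A $ k"]
      by (intro mult_mono E_le) auto
  qed
  \<comment> \<open>Boundedness of \<open>1 / n\<close> suffices for the defect; its value at 0 is 0
    by convention.\<close>
  have "(\<lambda>n. 1 / real n) \<in> O(\<lambda>_. 1)"
    by (rule bigoI[of _ 1], rule always_eventually) (auto simp: divide_le_eq_1)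
  from landau_o.big.mult[OF this R]
  have "(\<lambda>n. 1 / real n * R n) \<in> O(\<lambda>n. A $ (n - m))"
    by simp
  with gargantuan_middle_bigo[where h = h, OF garg h_le]
  have "(\<lambda>n. (\<Sum>k=m..n-m. h n k) + 1 / real n * R n) \<in> O(\<lambda>n. A $ (n - m))"
    by (rule sum_in_bigo(1)[where f = "\<lambda>n. \<Sum>k=m..n-m. h n k" and g = "\<lambda>n. 1 / real n * R n"])
  moreover have "eventually (\<lambda>n. (\<Sum>k=m..n-m. h n k) + 1 / real n * R n =
      C $ n - (\<Sum>k<m. E $ k * A $ (n - k))) sequentially"
    using eventually_ge_at_top[of "2 * m + 1"]
  proof eventually_elim
    case (elim n)
    have "fps_XD C = E * fps_XD A"
      using C by (simp add: fps_XD_def o_def mult_ac)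
    then have "real n * C $ n = (E * fps_XD A) $ n"
      by (metis fps_XD_nth)
    also have "\<dots> = (\<Sum>k\<le>n. E $ k * (real (n - k) * A $ (n - k)))"
      by (simp add: fps_mult_nth atLeast0AtMost)
    finally have "C $ n = (\<Sum>k\<le>n. h n k)"
      using elim by (simp add: h_def field_simps flip: sum_divide_distrib)
    also have "\<dots> = (\<Sum>k<m. h n k) + (\<Sum>k=m..n-m. h n k) + (\<Sum>j<m. h n (n - j))"
      using elim by (intro sum_split_ends) auto
    \<comment> \<open>Writing \<open>(n - k) / n = 1 - k / n\<close> separates the expansion from
      the negative half of \<open>R n / n\<close>.\<close>
    also have "(\<Sum>k<m. h n k) = (\<Sum>k<m. E $ k * A $ (n - k) - 1 / real n * (real k * E $ k * A $ (n - k)))"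
      using elim by (intro sum.cong) (auto simp: h_def field_simps)
    also have "\<dots> = (\<Sum>k<m. E $ k * A $ (n - k)) - 1 / real n * (\<Sum>k<m. real k * E $ k * A $ (n - k))"
      by (simp only: sum_subtractf sum_distrib_left)
    \<comment> \<open>At index \<open>n - j\<close> the factor is \<open>j / n\<close>, so the upper
      end supplies the positive half of \<open>R n / n\<close>.\<close>
    also have "(\<Sum>j<m. h n (n - j)) = 1 / real n * (\<Sum>k<m. real k * A $ k * E $ (n - k))"
      using elim unfolding sum_distrib_left by (intro sum.cong) (auto simp: h_def)
    finally show ?case
      by (simp add: R_def right_diff_distrib)
  qed
  ultimately show ?thesis
    by (rule landau_o.big.in_cong[THEN iffD1, rotated])
qed

section \<open>Labeled classes: irreducible objects and generating functions\<close>

lemma prob_SET_irreducible: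
  assumes "labeled_class A" "counting A n > 0" "component_embedding \<iota> C A"
  shows "measure_pmf.prob (pmf_of_set (objects_of_size A n)) {x. SET_irreducible \<iota> C x}
    = real (counting C n) / real (counting A n)"
proof -
  have fin: "finite (objects_of_size A n)"
    using assms(1) by (simp add: labeled_class_def)
  have ne: "objects_of_size A n \<noteq> {}"
    using assms(2) by (auto simp: counting_def)
  have "objects_of_size A n \<inter> {x. SET_irreducible \<iota> C x} = \<iota> ` objects_of_size C n"
    using assms(3) by (auto simp: component_embedding_def SET_irreducible_def objects_of_size_def)
  moreover have "card (\<iota> ` objects_of_size C n) = counting C n"
    unfolding counting_def using assms(3)
    by (intro card_image) (auto simp: component_embedding_def objects_of_size_def intro: inj_on_subset)
  ultimately show ?thesis
    using fin ne by (simp add: measure_pmf_of_set counting_def)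
qed

lemma egf_nth [simp]: "egf A $ n = real (counting A n) / fact n"
  by (simp add: egf_def)

lemma is_SET_deriv:
  assumes "is_SET A C"
  shows "fps_deriv (egf A) = fps_deriv (egf C) * egf A"
  using assms by (simp add: is_SET_def fps_compose_deriv mult.commute)

lemma is_SEQ_mult:
  assumes "is_SEQ A D"
  shows "egf A * (1 - egf D) = 1"
  using assms by (simp add: is_SEQ_def fps_divide_unit inverse_mult_eq_1)

text \<open>In \<open>A = 1 + D A\<close> all coefficients are nonnegative and \<open>A\<close> has
  constant term 1, so the coefficient of \<open>D\<close> is itself one summand of the convolution.
  This supplies the bound on the coefficients of \<open>1 - D\<close>.\<close>

lemma is_SEQ_counting_le:
  assumes "is_SEQ A D" and "k > 0"
  shows "egf D $ k \<le> egf A $ k"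
proof -
  have A: "egf A = 1 + egf D * egf A"
    using is_SEQ_mult[OF assms(1)] by (simp add: algebra_simps)
  have D0: "egf D $ 0 = 0"
    using assms(1) by (simp add: is_SEQ_def)
  have A0: "egf A $ 0 = 1"
    by (subst A) (simp add: D0[simplified])
  have "egf D $ k = egf D $ k * egf A $ (k - k)"
    using A0 by simp
  also have "\<dots> \<le> (\<Sum>i=0..k. egf D $ i * egf A $ (k - i))"
    by (rule member_le_sum) auto
  also have "\<dots> = egf A $ k"
    using assms(2) by (subst (2) A) (simp add: fps_mult_nth)
  finally show ?thesis .
qed

section \<open>The asymptotic scale and the expansion\<close>

lemma SET_scale_eq:
  assumes "k \<le> n"
  shows "SET_scale A k n = egf A $ (n - k) / (fact k * egf A $ n)"
  using assms by (simp add: SET_scale_def binomial_fact mult_ac)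

text \<open>For large \<open>n\<close> the quotient of consecutive scale functions is
  \<open>1 / (k + 1)\<close> times the quotient of consecutive coefficients at \<open>n - k\<close>,
  which tends to 0 by the first gargantuan condition.\<close>

lemma SET_scale_smallo:
  assumes "gargantuan_class A" and "\<And>n. counting A n > 0"
  shows "SET_scale A (k + 1) \<in> o(SET_scale A k)"
proof (rule smalloI_tendsto)
  define a where "a = fps_nth (egf A)"
  have pos: "a n > 0" for n
    using assms(2) by (simp add: a_def)
  have "(\<lambda>n. a (n - 1) / a n) \<longlonglongrightarrow> 0"
    using assms(1) by (simp add: gargantuan_class_def gargantuan_def a_def)
  from tendsto_mult_right_zero[OF filterlim_compose[OF this filterlim_minus_const_nat_at_top[of k]],
      of "1 / real (k + 1)"]
  have "(\<lambda>n. 1 / real (k + 1) * (a (n - k - 1) / a (n - k))) \<longlonglongrightarrow> 0" .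
  moreover have "eventually (\<lambda>n. 1 / real (k + 1) * (a (n - k - 1) / a (n - k)) =
      SET_scale A (k + 1) n / SET_scale A k n) sequentially"
    using eventually_ge_at_top[of "k + 1"]
  proof eventually_elim
    case (elim n)
    then show ?case
      using pos[of n] pos[of "n - k"]
      by (subst (1 2) SET_scale_eq) (auto simp: a_def divide_simps simp del: of_nat_Suc of_nat_add egf_nth)
  qed
  ultimately show "(\<lambda>n. SET_scale A (k + 1) n / SET_scale A k n) \<longlonglongrightarrow> 0"
    by (rule Lim_transform_eventually)
  show "eventually (\<lambda>n. SET_scale A k n \<noteq> 0) sequentially"
    using eventually_ge_at_top[of k]
    by eventually_elim (use assms(2) in \<open>simp add: SET_scale_def less_imp_neq[symmetric]\<close>)
qed

text \<open>Dividing the bound for the logarithm by the coefficient \<open>egf A $ n\<close> turns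
  it into the expansion of the counting ratio.\<close>

lemma SET_expansion:
  assumes "gargantuan_class A" and pos: "\<And>n. counting A n > 0"
    and SET: "is_SET A C" and SEQ: "is_SEQ A D"
  shows "expansion_on_scale 0 (SET_scale A)
    (\<lambda>n. real (counting C n) / real (counting A n)) (SET_term A D)"
  unfolding expansion_on_scale_def
proof (intro conjI allI impI SET_scale_smallo assms(1) pos)
  fix r
  define E where "E = 1 - egf D"
  have D0: "counting D 0 = 0"
    using SEQ by (simp add: is_SEQ_def)
  have AE: "egf A * E = 1"
    unfolding E_def by (rule is_SEQ_mult[OF SEQ])
  have "egf A $ 0 * E $ 0 = 1"
    using arg_cong[OF AE, of "\<lambda>f. f $ 0"] by simp
  then have A0: "egf A $ 0 = 1"
    using D0 by (simp add: E_def)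
  \<comment> \<open>At \<open>k = 0\<close> both sides are 1; for \<open>k > 0\<close> the
    coefficient of \<open>E\<close> is minus that of \<open>egf D\<close>.\<close>
  have E_le: "\<bar>E $ k\<bar> \<le> \<bar>egf A $ k\<bar>" for k
    using is_SEQ_counting_le[OF SEQ, of k] A0 D0 by (cases "k = 0") (auto simp: E_def)
  have C: "fps_deriv (egf C) = fps_deriv (egf A) * E"
    using AE by (simp add: is_SET_deriv[OF SET] mult.assoc)
  have "gargantuan (fps_nth (egf A))"
    using assms(1) by (simp add: gargantuan_class_def flip: egf_nth)
  from gargantuan_log_bigo[OF this AE E_le C, of "r + 1"]
  have "(\<lambda>n. egf C $ n - (\<Sum>k<r+1. E $ k * egf A $ (n - k))) \<in> O(\<lambda>n. egf A $ (n - (r + 1)))" .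
  then have "(\<lambda>n. 1 / egf A $ n * (egf C $ n - (\<Sum>k<r+1. E $ k * egf A $ (n - k))))
      \<in> O(\<lambda>n. 1 / egf A $ n * egf A $ (n - (r + 1)))"
    by (intro landau_o.big.mult_left)
  also have "(\<lambda>n. 1 / egf A $ n * egf A $ (n - (r + 1))) \<in> O(SET_scale A (r + 1))"
  proof (rule bigoI)
    \<comment> \<open>The constant \<open>fact (r + 1)\<close> is the denominator that the binomial
      coefficient contributes to the scale.\<close>
    show "eventually (\<lambda>n. norm (1 / egf A $ n * egf A $ (n - (r + 1)))
        \<le> fact (r + 1) * norm (SET_scale A (r + 1) n)) sequentially"
      using eventually_ge_at_top[of "r + 1"]
      by eventually_elim (simp add: SET_scale_eq abs_mult mult_ac del: fact_Suc)
  qed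
  finally have "(\<lambda>n. 1 / egf A $ n * (egf C $ n - (\<Sum>k<r+1. E $ k * egf A $ (n - k))))
      \<in> O(SET_scale A (r + 1))" .
  moreover have "eventually (\<lambda>n. 1 / egf A $ n * (egf C $ n - (\<Sum>k<r+1. E $ k * egf A $ (n - k))) =
      real (counting C n) / real (counting A n) - (\<Sum>k=0..r. SET_term A D k n)) sequentially"
    using eventually_ge_at_top[of "r + 1"]
  proof eventually_elim
    case (elim n)
    \<comment> \<open>The factorials of the three generating function coefficients combine to
      \<open>n choose k\<close>; the minus sign for \<open>k > 0\<close> comes from
      \<open>E = 1 - egf D\<close>.\<close>
    have "1 / egf A $ n * (E $ k * egf A $ (n - k)) = SET_term A D k n" if "k \<le> r" for k
      using that elim D0 pos[of n]
      by (cases "k = 0") (auto simp: SET_term_def E_def binomial_fact field_simps)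
    then have "(\<Sum>k<r+1. 1 / egf A $ n * (E $ k * egf A $ (n - k))) = (\<Sum>k=0..r. SET_term A D k n)"
      by (intro sum.cong) auto
    then show ?case
      unfolding right_diff_distrib sum_distrib_left by (simp only:) simp
  qed
  ultimately show "(\<lambda>n. real (counting C n) / real (counting A n) - (\<Sum>k=0..r. SET_term A D k n))
      \<in> O(SET_scale A (r + 1))"
    by (rule landau_o.big.in_cong[THEN iffD1, rotated])
qed

text \<open>Landau classes see a scale function only up to \<open>\<Theta>\<close>. This allows the
  terms themselves to replace the scale when no coefficient vanishes.\<close>

lemma expansion_on_scale_cong_bigtheta:
  assumes "expansion_on_scale m \<phi> a f" and "\<And>k. k \<ge> m \<Longrightarrow> \<psi> k \<in> \<Theta>(\<phi> k)"
  shows "expansion_on_scale m \<psi> a f"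
  unfolding expansion_on_scale_def
proof (intro conjI allI impI)
  fix k assume k: "m \<le> k"
  then have "m \<le> k + 1" by simp
  note eqs = landau_o.big.cong_bigtheta[OF assms(2)[OF this]]
    landau_o.small.cong_bigtheta[OF assms(2)[OF k]]
    landau_o.small.in_cong_bigtheta[OF assms(2)[OF \<open>m \<le> k + 1\<close>]]
  show "(\<lambda>n. a n - (\<Sum>i=m..k. f i n)) \<in> O(\<psi> (k + 1))"
    using assms(1) k unfolding eqs expansion_on_scale_def by blast
  show "\<psi> (k + 1) \<in> o(\<psi> k)"
    using assms(1) k unfolding eqs expansion_on_scale_def by blast
qed

lemma SET_term_bigtheta:
  assumes "\<And>n. counting A n > 0" and "\<forall>k\<ge>1. counting D k \<noteq> 0"
  shows "SET_term A D k \<in> \<Theta>(SET_scale A k)"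
proof (cases "k = 0")
  case True
  then have "SET_term A D k = SET_scale A k"
    using assms(1) by (auto simp: SET_term_def SET_scale_def fun_eq_iff less_imp_neq[symmetric])
  then show ?thesis by simp
next
  case False
  then have "SET_term A D k = (\<lambda>n. - real (counting D k) * SET_scale A k n)"
    by (auto simp: SET_term_def SET_scale_def)
  then show ?thesis
    using False assms(2) by simp
qed

theorem mainTheorem1:
  fixes A :: "'a lclass" and C :: "'c lclass" and D :: "'d lclass"
  assumes "labeled_class A" and "labeled_class C" and "labeled_class D"
    and "gargantuan_class A"
    and "\<And>n. counting A n > 0"
    and "is_SET A C" and "is_SEQ A D"
  shows "(\<forall>\<iota> n. component_embedding \<iota> C A \<longrightarrow>
            measure_pmf.prob (pmf_of_set (objects_of_size A n)) {x. SET_irreducible \<iota> C x}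
              = real (counting C n) / real (counting A n)) \<and>
         expansion_on_scale 0 (SET_scale A)
           (\<lambda>n. real (counting C n) / real (counting A n)) (SET_term A D) \<and>
         ((\<forall>k\<ge>1. counting D k \<noteq> 0) \<longrightarrow>
            asymp_series 0
              (\<lambda>n. real (counting C n) / real (counting A n)) (SET_term A D))"
proof (intro conjI allI impI)
  show exp: "expansion_on_scale 0 (SET_scale A)
      (\<lambda>n. real (counting C n) / real (counting A n)) (SET_term A D)"
    using assms by (intro SET_expansion)
  show "asymp_series 0 (\<lambda>n. real (counting C n) / real (counting A n)) (SET_term A D)"
    if "\<forall>k\<ge>1. counting D k \<noteq> 0"
    unfolding asymp_series_def using assms(5) that
    by (intro expansion_on_scale_cong_bigtheta[OF exp] SET_term_bigtheta)
qed (use assms in \<open>simp add: prob_SET_irreducible\<close>)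

end
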